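(* Let $X\subseteq\mathbb R^d$ be closed and convex with nonempty interior, and let $Q:X\to\mathbb R^d$ be a continuous vector field whose projected dynamics are well-behaved (as defined in the context). Then the dynamic solver $g_Q:X\to X\sqcup\{\dagger\}$ is measurable, where $X$ carries its Borel $\sigma$-algebra and $X\sqcup\{\dagger\}$ the disjoint-union $\sigma$-algebra.
   Context: Tangent cone: $\operatorname{TC}_X(x)=\overline{\{\lambda(y-x): y\in X,\lambda\ge0\}}$, and $\Pi_{\operatorname{TC}_X(x)}$ is the Euclidean projection onto it. Projected vector field: $Q^{\Pi}(x):=\Pi_{\operatorname{TC}_X(x)}Q(x)$. A solution of the projected dynamics from $x_0\in X$ on an interval $I\ni 0$ in $[0,\infty)$ is an $X$-valued path, absolutely continuous on compact subintervals of $I$, with $x(0)=x_0$ and $\dot x(t)=Q^{\Pi}(x(t))$ for a.e. $t$. Well-behaved projected dynamics: there are a lower semicontinuous function $\tau:X\to(0,\infty]$ (maximal existence time) and a map $G:D\to X$, continuous on $D=\{(x_0,t)\in X\times[0,\infty): t<\tau(x_0)\}$, such that for each $x_0\in X$ the path $t\mapsto G(x_0,t)$ is a solution from $x_0$ on $[0,\tau(x_0))$, and is maximal: no solution in $X$ from $x_0$ extends it beyond $\tau(x_0)$, and any other solution from $x_0$ agrees with it on their common domain. Dynamic solver: $g_Q(x_0):=\lim_{t\to\infty}G(x_0,t)$ if $\tau(x_0)=\infty$ and the limit exists in $X$; otherwise $g_Q(x_0):=\dagger$, where $\dagger$ is an extra point not in $X$. *)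

theory Defs
  imports "HOL-Analysis.Analysis"
begin

definition tangent_cone :: "'a::euclidean_space set \<Rightarrow> 'a \<Rightarrow> 'a set" where
  "tangent_cone X x = closure {c *\<^sub>R (y - x) | c y. y \<in> X \<and> 0 \<le> c}"

definition projected_field :: "'a::euclidean_space set \<Rightarrow> ('a \<Rightarrow> 'a) \<Rightarrow> 'a \<Rightarrow> 'a" where
  "projected_field X Q x = closest_point (tangent_cone X x) (Q x)"

text \<open>A pair \<open>(u, v)\<close> in \<open>P\<close> stands for the interval with end points \<open>u \<le> v\<close>;
  the intervals in \<open>P\<close> are required to be non-overlapping.\<close>

definition absolutely_continuous_on :: "real set \<Rightarrow> (real \<Rightarrow> 'a::metric_space) \<Rightarrow> bool" where
  "absolutely_continuous_on S f \<longleftrightarrow>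
     (\<forall>\<epsilon>>0. \<exists>\<delta>>0. \<forall>P. finite P \<longrightarrow>
        (\<forall>(u, v) \<in> P. u \<le> v \<and> {u..v} \<subseteq> S) \<longrightarrow>
        disjoint_family_on (\<lambda>(u, v). {u<..<v}) P \<longrightarrow>
        (\<Sum>(u, v)\<in>P. v - u) < \<delta> \<longrightarrow>
        (\<Sum>(u, v)\<in>P. dist (f u) (f v)) < \<epsilon>)"

text \<open>A path is a total function on the reals of which only the values on \<open>I\<close> matter.\<close>

definition projected_solution ::
    "'a::euclidean_space set \<Rightarrow> ('a \<Rightarrow> 'a) \<Rightarrow> 'a \<Rightarrow> real set \<Rightarrow> (real \<Rightarrow> 'a) \<Rightarrow> bool" where
  "projected_solution X Q x\<^sub>0 I x \<longleftrightarrow>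
     is_interval I \<and> 0 \<in> I \<and> I \<subseteq> {0..} \<and>
     x ` I \<subseteq> X \<and>
     (\<forall>a b. {a..b} \<subseteq> I \<longrightarrow> absolutely_continuous_on {a..b} x) \<and>
     x 0 = x\<^sub>0 \<and>
     (AE t in lebesgue. t \<in> I \<longrightarrow>
        (x has_vector_derivative projected_field X Q (x t)) (at t within I))"

definition lower_semicontinuous_on :: "'a::topological_space set \<Rightarrow> ('a \<Rightarrow> ereal) \<Rightarrow> bool" where
  "lower_semicontinuous_on X f \<longleftrightarrow> (\<forall>x\<in>X. f x \<le> Liminf (at x within X) f)"

definition flow_domain :: "'a set \<Rightarrow> ('a \<Rightarrow> ereal) \<Rightarrow> ('a \<times> real) set" where
  "flow_domain X \<tau> = {(x\<^sub>0, t). x\<^sub>0 \<in> X \<and> 0 \<le> t \<and> ereal t < \<tau> x\<^sub>0}"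

text \<open>The last two conjuncts express maximality: no solution properly extends
  \<open>t \<mapsto> G (x\<^sub>0, t)\<close>, and every solution from \<open>x\<^sub>0\<close> agrees with it where both are defined.\<close>

definition well_behaved_dynamics ::
    "'a::euclidean_space set \<Rightarrow> ('a \<Rightarrow> 'a) \<Rightarrow> ('a \<Rightarrow> ereal) \<Rightarrow> ('a \<times> real \<Rightarrow> 'a) \<Rightarrow> bool" where
  "well_behaved_dynamics X Q \<tau> G \<longleftrightarrow>
     (\<forall>x\<^sub>0\<in>X. 0 < \<tau> x\<^sub>0) \<and>
     lower_semicontinuous_on X \<tau> \<and>
     G ` flow_domain X \<tau> \<subseteq> X \<and>
     continuous_on (flow_domain X \<tau>) G \<and>
     (\<forall>x\<^sub>0\<in>X. let I = {t. (x\<^sub>0, t) \<in> flow_domain X \<tau>} in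
        projected_solution X Q x\<^sub>0 I (\<lambda>t. G (x\<^sub>0, t)) \<and>
        (\<forall>J y. projected_solution X Q x\<^sub>0 J y \<longrightarrow>
           \<not> (I \<subset> J \<and> (\<forall>t\<in>I. y t = G (x\<^sub>0, t)))) \<and>
        (\<forall>J y. projected_solution X Q x\<^sub>0 J y \<longrightarrow>
           (\<forall>t\<in>I \<inter> J. y t = G (x\<^sub>0, t))))"

text \<open>\<open>Inr ()\<close> is the extra point \<open>\<dagger>\<close>. By \<open>well_behaved_dynamics\<close>, \<open>\<tau>\<close> and
  \<open>G\<close> are determined by \<open>Q\<close> on \<open>X\<close> and on the flow domain, so the solver depends on \<open>Q\<close> only.\<close>

definition dynamic_solver ::
    "'a::euclidean_space set \<Rightarrow> ('a \<Rightarrow> ereal) \<Rightarrow> ('a \<times> real \<Rightarrow> 'a) \<Rightarrow> 'a \<Rightarrow> 'a + unit" where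
  "dynamic_solver X \<tau> G x\<^sub>0 =
     (if \<tau> x\<^sub>0 = \<infinity> \<and> (\<exists>l\<in>X. ((\<lambda>t. G (x\<^sub>0, t)) \<longlongrightarrow> l) at_top)
      then Inl (Lim at_top (\<lambda>t. G (x\<^sub>0, t)))
      else Inr ())"

definition disjoint_union_algebra :: "'a measure \<Rightarrow> 'b measure \<Rightarrow> ('a + 'b) measure" where
  "disjoint_union_algebra M N =
     sigma (space M <+> space N)
       {C. C \<subseteq> space M <+> space N \<and> Inl -` C \<in> sets M \<and> Inr -` C \<in> sets N}"

lemma space_disjoint_union_algebra:
  "space (disjoint_union_algebra M N) = space M <+> space N"
  unfolding disjoint_union_algebra_def by (rule space_measure_of) auto

lemma sets_disjoint_union_algebra:
  "sets (disjoint_union_algebra M N) =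
     {C. C \<subseteq> space M <+> space N \<and> Inl -` C \<in> sets M \<and> Inr -` C \<in> sets N}"
    (is "_ = ?S")
proof -
  have "sigma_algebra (space M <+> space N) ?S"
    unfolding sigma_algebra_iff2
  proof (intro conjI ballI allI impI)
    fix C assume C: "C \<in> ?S"
    have "Inl -` (space M <+> space N - C) = space M - Inl -` C"
         "Inr -` (space M <+> space N - C) = space N - Inr -` C"
      by auto
    with C show "space M <+> space N - C \<in> ?S"
      by auto
  next
    fix A :: "nat \<Rightarrow> ('a + 'b) set" assume "range A \<subseteq> ?S"
    then show "\<Union> (range A) \<in> ?S"
      by (auto simp: vimage_UN intro!: sets.countable_UN)
  qed auto
  then show ?thesis
    unfolding disjoint_union_algebra_def
    by (subst sets_measure_of) (auto simp: sigma_algebra.sigma_sets_eq)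
qed

end

theory Submission
  imports Defs
begin

text \<open>Lower semicontinuity makes \<open>{x \<in> X. \<tau> x > n}\<close> relatively open, so the set \<open>A\<close> where
  \<open>\<tau> = \<infinity>\<close> is Borel. On \<open>A\<close> the trajectory converges iff it is Cauchy; the condition
  \<open>dist (G (x, s)) (G (x, t)) \<le> 1 / (k + 1)\<close> for all \<open>s, t \<ge> n\<close> is an intersection of
  relatively closed conditions on \<open>x\<close>, so no countable set of times is needed and the convergence
  set is Borel. On it the limit is the pointwise limit of the continuous maps \<open>x \<mapsto> G (x, n)\<close>.\<close>

text \<open>Since \<open>a < f x \<le> Liminf (at x within X) f\<close>, the bound
  \<open>a < f y\<close> holds on a punctured neighbourhood of \<open>x\<close> in \<open>X\<close>.
  At \<open>x\<close> itself it holds by choice of \<open>x\<close>.\<close>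

lemma lower_semicontinuous_on_openin:
  fixes f :: "'a::topological_space \<Rightarrow> ereal"
  assumes "lower_semicontinuous_on X f"
  shows "openin (top_of_set X) {x\<in>X. a < f x}"
proof (subst openin_subopen, intro ballI)
  fix x assume x: "x \<in> {x\<in>X. a < f x}"
  with assms have "a < Liminf (at x within X) f"
    unfolding lower_semicontinuous_on_def using less_le_trans by blast
  then have "eventually (\<lambda>y. a < f y) (at x within X)"
    by (rule less_LiminfD)
  then obtain S where "open S" "x \<in> S" "\<forall>y\<in>S. y \<noteq> x \<longrightarrow> y \<in> X \<longrightarrow> a < f y"
    by (auto simp: eventually_at_topological)
  with x show "\<exists>T. openin (top_of_set X) T \<and> x \<in> T \<and> T \<subseteq> {x\<in>X. a < f x}"
    by (intro exI[of _ "X \<inter> S"]) (auto simp: openin_open)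
qed

lemma lower_semicontinuous_on_infinity_borel:
  fixes f :: "'a::topological_space \<Rightarrow> ereal"
  assumes "lower_semicontinuous_on X f" and "X \<in> sets borel"
  shows "{x\<in>X. f x = \<infinity>} \<in> sets borel"
proof -
  have "{x\<in>X. a < f x} \<in> sets borel" for a
    using lower_semicontinuous_on_openin[OF assms(1), of a] assms(2)
    by (auto simp: openin_open)
  then have "(\<Inter>n::nat. {x\<in>X. ereal (real n) < f x}) \<in> sets borel"
    by (intro sets.countable_INT) auto
  also have "(\<Inter>n::nat. {x\<in>X. ereal (real n) < f x}) = {x\<in>X. f x = \<infinity>}"
  proof (intro set_eqI iffI)
    fix x assume x: "x \<in> (\<Inter>n::nat. {x\<in>X. ereal (real n) < f x})"
    have "f x = \<infinity>"
    proof (rule ereal_top)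
      fix B :: real
      obtain n :: nat where "B \<le> real n"
        using real_arch_simple by blast
      moreover have "ereal (real n) < f x"
        using x by blast
      ultimately show "ereal B \<le> f x"
        by (meson ereal_less_eq(3) less_imp_le order_trans)
    qed
    with x show "x \<in> {x\<in>X. f x = \<infinity>}" by auto
  qed auto
  finally show ?thesis .
qed

text \<open>Completeness removes the unknown limit and leaves countable quantifiers over
  \<open>k\<close> and \<open>n\<close>. Those over \<open>s\<close> and \<open>t\<close> stay
  uncountable, so the bound is non-strict: for continuous \<open>f\<close> in a parameter it then
  cuts out closed sets.\<close>

lemma convergent_at_top_iff_Cauchy:
  fixes f :: "real \<Rightarrow> 'b::complete_space"
  shows "(\<exists>l. (f \<longlongrightarrow> l) at_top) \<longleftrightarrow>
    (\<forall>k::nat. \<exists>n::nat. \<forall>s\<ge>real n. \<forall>t\<ge>real n. dist (f s) (f t) \<le> 1 / (real k + 1))"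
    (is "_ \<longleftrightarrow> ?C")
proof
  assume "\<exists>l. (f \<longlongrightarrow> l) at_top"
  then have "cauchy_filter (filtermap f at_top)"
    using nhds_imp_cauchy_filter unfolding filterlim_def by blast
  then have *: "\<exists>P. eventually P at_top \<and> (\<forall>x y. P x \<and> P y \<longrightarrow> dist (f x) (f y) < e)"
    if "e > 0" for e
    using that unfolding cauchy_filter_metric_filtermap by blast
  show ?C
  proof
    fix k :: nat
    obtain P N where P: "\<forall>x y. P x \<and> P y \<longrightarrow> dist (f x) (f y) < 1 / (real k + 1)"
      and N: "\<forall>t\<ge>N. P t"
      using *[of "1 / (real k + 1)"] by (auto simp: eventually_at_top_linorder)
    obtain n :: nat where "N \<le> real n"
      using real_arch_simple by blast
    with P N show "\<exists>n::nat. \<forall>s\<ge>real n. \<forall>t\<ge>real n. dist (f s) (f t) \<le> 1 / (real k + 1)"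
      by (meson less_imp_le order_trans)
  qed
next
  assume C: ?C
  have "cauchy_filter (filtermap f at_top)"
    unfolding cauchy_filter_metric_filtermap
  proof (intro allI impI)
    fix e :: real assume "e > 0"
    then obtain k :: nat where k: "1 / (real k + 1) < e"
      using nat_approx_posE by (metis of_nat_Suc add.commute)
    obtain n :: nat where "\<forall>s\<ge>real n. \<forall>t\<ge>real n. dist (f s) (f t) \<le> 1 / (real k + 1)"
      using C by blast
    with k show "\<exists>P. eventually P at_top \<and> (\<forall>x y. P x \<and> P y \<longrightarrow> dist (f x) (f y) < e)"
      by (intro exI[of _ "\<lambda>t. t \<ge> real n"]) (auto intro: le_less_trans)
  qed
  moreover have "filtermap f at_top \<noteq> bot"
    by (simp add: filtermap_bot_iff)
  \<comment> \<open>Completeness in filter form: a proper Cauchy filter lies below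
    \<open>nhds l\<close> for some \<open>l\<close>, which is convergence to
    \<open>l\<close>.\<close>
  ultimately obtain l where "filtermap f at_top \<le> nhds l"
    using complete_UNIV unfolding complete_uniform by auto
  then show "\<exists>l. (f \<longlongrightarrow> l) at_top"
    unfolding filterlim_def by blast
qed

lemma convergence_set_borel:
  fixes F :: "'a::topological_space \<Rightarrow> real \<Rightarrow> 'b::complete_space"
  assumes "A \<in> sets borel" and "\<And>t. 0 \<le> t \<Longrightarrow> continuous_on A (\<lambda>x. F x t)"
  shows "{x\<in>A. \<exists>l. (F x \<longlongrightarrow> l) at_top} \<in> sets borel"
proof -
  define S where "S k n = {x\<in>A. \<forall>s\<ge>real n. \<forall>t\<ge>real n. dist (F x s) (F x t) \<le> 1 / (real k + 1)}"
    for k n :: nat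
  have "closedin (top_of_set A) (S k n)" for k n
  proof -
    let ?T = "\<lambda>(s, t). {x\<in>A. dist (F x s) (F x t) \<le> 1 / (real k + 1)}"
    have "closedin (top_of_set A) (?T p)" if "p \<in> {real n..} \<times> {real n..}" for p
    proof -
      obtain s t where p: "p = (s, t)" by (cases p)
      have "continuous_on A (\<lambda>x. dist (F x s) (F x t))"
        using that p by (intro continuous_on_dist assms(2)) auto
      then have "closedin (top_of_set A)
          (A \<inter> (\<lambda>x. dist (F x s) (F x t)) -` {..1 / (real k + 1)})"
        by (rule continuous_closedin_preimage) simp
      then show ?thesis
        using p by (simp add: vimage_def Collect_conj_eq)
    qed
    \<comment> \<open>This intersection is uncountable; closedness survives it, whereas Borel
      measurability alone would not.\<close>
    then have "closedin (top_of_set A) (\<Inter>p\<in>{real n..} \<times> {real n..}. ?T p)"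
      by (intro closedin_INT) auto
    also have "(\<Inter>p\<in>{real n..} \<times> {real n..}. ?T p) = S k n"
      unfolding S_def by fastforce
    finally show ?thesis .
  qed
  then have "S k n \<in> sets borel" for k n
    using assms(1) unfolding closedin_closed by (metis borel_closed sets.Int)
  then have "(\<Inter>k. \<Union>n. S k n) \<in> sets borel"
    by (intro sets.countable_INT sets.countable_UN) auto
  also have "(\<Inter>k. \<Union>n. S k n) = {x\<in>A. \<exists>l. (F x \<longlongrightarrow> l) at_top}"
    unfolding S_def convergent_at_top_iff_Cauchy by blast
  finally show ?thesis .
qed

text \<open>A limit along real times is also the limit along the integer times
  \<open>real n\<close>, which reduces the claim to a pointwise limit of a sequence of measurable
  maps.\<close>

lemma borel_measurable_Lim_at_top:
  fixes F :: "'a::topological_space \<Rightarrow> real \<Rightarrow> 'b::metric_space"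
  assumes "\<And>t. 0 \<le> t \<Longrightarrow> continuous_on C (\<lambda>x. F x t)"
    and "\<And>x. x \<in> C \<Longrightarrow> \<exists>l. (F x \<longlongrightarrow> l) at_top"
  shows "(\<lambda>x. Lim at_top (F x)) \<in> borel_measurable (restrict_space borel C)"
proof (rule borel_measurable_LIMSEQ_metric)
  show "(\<lambda>x. F x (real n)) \<in> borel_measurable (restrict_space borel C)" for n
    by (intro borel_measurable_continuous_on_restrict assms(1)) simp
next
  fix x assume "x \<in> space (restrict_space borel C)"
  then obtain l where l: "(F x \<longlongrightarrow> l) at_top"
    using assms(2) by (auto simp: space_restrict_space)
  then have "Lim at_top (F x) = l"
    by (intro tendsto_Lim) auto
  with l show "(\<lambda>n. F x (real n)) \<longlonglongrightarrow> Lim at_top (F x)"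
    using filterlim_compose filterlim_real_sequentially by blast
qed

text \<open>A preimage splits along \<open>C\<close>: inside, it is a preimage under
  \<open>f\<close>; outside, it is everything or nothing, according to whether the extra point is in
  the target set. Measurability of \<open>f\<close> is asked on \<open>C\<close> only, because
  \<open>Lim\<close> has no meaning where there is no limit.\<close>

lemma measurable_if_Inl_Inr:
  assumes "C \<in> sets M" and f: "f \<in> measurable (restrict_space M C) N"
  shows "(\<lambda>x. if x \<in> C then Inl (f x) else Inr ())
    \<in> measurable M (disjoint_union_algebra N (count_space {()}))"
    (is "?g \<in> _")
proof (rule measurableI)
  have C: "C \<subseteq> space M"
    using assms(1) by (rule sets.sets_into_space)
  show "?g x \<in> space (disjoint_union_algebra N (count_space {()}))" if "x \<in> space M" for x
    using measurable_space[OF f, of x] that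
    by (auto simp: space_disjoint_union_algebra space_restrict_space)
  fix E assume "E \<in> sets (disjoint_union_algebra N (count_space {()}))"
  then have "Inl -` E \<in> sets N"
    by (simp add: sets_disjoint_union_algebra)
  then have "f -` Inl -` E \<inter> space (restrict_space M C) \<in> sets (restrict_space M C)"
    by (rule measurable_sets[OF f])
  then have "f -` Inl -` E \<inter> C \<in> sets M"
    using C assms(1) by (simp add: sets_restrict_space_iff space_restrict_space Int_absorb2)
  moreover have "?g -` E \<inter> space M
      = (f -` Inl -` E \<inter> C) \<union> (if Inr () \<in> E then space M - C else {})"
    (is "?L = ?R")
  proof (rule set_eqI)
    show "x \<in> ?L \<longleftrightarrow> x \<in> ?R" for x
      using C by (cases "x \<in> C") auto
  qed
  ultimately show "?g -` E \<inter> space M \<in> sets M"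
    using assms(1) by auto
qed

theorem proposition4p6:
  fixes X :: "(real ^ 'd) set"
    and Q :: "real ^ 'd \<Rightarrow> real ^ 'd"
    and \<tau> :: "real ^ 'd \<Rightarrow> ereal"
    and G :: "(real ^ 'd) \<times> real \<Rightarrow> real ^ 'd"
  assumes "closed X" and "convex X" and "interior X \<noteq> {}"
    and "continuous_on X Q"
    and "well_behaved_dynamics X Q \<tau> G"
  shows "dynamic_solver X \<tau> G
           \<in> measurable (restrict_space borel X)
               (disjoint_union_algebra (restrict_space borel X) (count_space {()}))"
proof -
  define F where "F = (\<lambda>x t. G (x, t))"
  define A where "A = {x\<in>X. \<tau> x = \<infinity>}"
  \<comment> \<open>Unlike \<open>dynamic_solver\<close>, \<open>C\<close> does not ask the limit to
    lie in \<open>X\<close>; \<open>lim_in\<close> below shows that this makes no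
    difference.\<close>
  define C where "C = {x\<in>A. \<exists>l. (F x \<longlongrightarrow> l) at_top}"
  have lsc: "lower_semicontinuous_on X \<tau>" and GX: "G ` flow_domain X \<tau> \<subseteq> X"
    and G: "continuous_on (flow_domain X \<tau>) G"
    using assms(5) unfolding well_behaved_dynamics_def by auto
  \<comment> \<open>On \<open>A\<close> no trajectory ends, so each time slice of \<open>G\<close>
    is defined and continuous on all of \<open>A\<close>.\<close>
  have dom: "(x, t) \<in> flow_domain X \<tau>" if "x \<in> A" "0 \<le> t" for x t
    using that by (simp add: flow_domain_def A_def)
  have cont: "continuous_on A (\<lambda>x. F x t)" if "0 \<le> t" for t
    unfolding F_def using dom that
    by (intro continuous_on_compose2[OF G]) (auto intro!: continuous_intros)
  have lim_in: "l \<in> X" if "x \<in> A" "(F x \<longlongrightarrow> l) at_top" for x l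
  proof (rule Lim_in_closed_set[OF assms(1) _ _ that(2)])
    show "\<forall>\<^sub>F t in at_top. F x t \<in> X"
      using eventually_ge_at_top[of 0] by eventually_elim (use dom that(1) GX F_def in auto)
  qed simp
  have "A \<in> sets borel"
    unfolding A_def using lsc assms(1) by (intro lower_semicontinuous_on_infinity_borel) auto
  then have Cb: "C \<in> sets borel"
    unfolding C_def using cont by (rule convergence_set_borel)
  have CX: "C \<subseteq> X"
    by (auto simp: C_def A_def)
  with Cb have C: "C \<in> sets (restrict_space borel X)"
    using assms(1) by (simp add: sets_restrict_space_iff)
  have "(\<lambda>x. Lim at_top (F x)) \<in> borel_measurable (restrict_space borel C)"
    by (rule borel_measurable_Lim_at_top)
       (auto simp: C_def intro: continuous_on_subset[OF cont])
  also have "restrict_space borel C = restrict_space (restrict_space borel X) C"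
    using CX assms(1) Cb by (subst restrict_restrict_space) (simp_all add: Int_absorb1)
  finally have "(\<lambda>x. Lim at_top (F x))
      \<in> measurable (restrict_space (restrict_space borel X) C) (restrict_space borel X)"
  \<comment> \<open>The codomain shrinks from the whole space to \<open>X\<close>, since the limits
    taken on \<open>C\<close> lie in \<open>X\<close>.\<close>
  proof (rule measurable_restrict_space2[rotated])
    have "Lim at_top (F x) \<in> X" if x: "x \<in> C" for x
    proof -
      obtain l where l: "(F x \<longlongrightarrow> l) at_top"
        using x by (auto simp: C_def)
      then have "Lim at_top (F x) = l"
        by (intro tendsto_Lim) auto
      with x lim_in[OF _ l] show ?thesis
        by (simp add: C_def)
    qed
    then show "(\<lambda>x. Lim at_top (F x)) \<in> space (restrict_space (restrict_space borel X) C) \<rightarrow> X"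
      by (simp add: space_restrict_space)
  qed
  with C have "(\<lambda>x. if x \<in> C then Inl (Lim at_top (F x)) else Inr ())
      \<in> measurable (restrict_space borel X)
          (disjoint_union_algebra (restrict_space borel X) (count_space {()}))"
    by (rule measurable_if_Inl_Inr)
  \<comment> \<open>Agreement is claimed on \<open>X\<close> only: outside \<open>X\<close>,
    \<open>\<tau>\<close> and \<open>G\<close> are unconstrained and the solver may take any
    form.\<close>
  moreover have "dynamic_solver X \<tau> G x = (if x \<in> C then Inl (Lim at_top (F x)) else Inr ())"
    if "x \<in> space (restrict_space borel X)" for x
  proof -
    have "x \<in> C \<longleftrightarrow> x \<in> A \<and> (\<exists>l\<in>X. (F x \<longlongrightarrow> l) at_top)"
      unfolding C_def using lim_in by blast
    moreover have "x \<in> A \<longleftrightarrow> \<tau> x = \<infinity>"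
      using that by (simp add: A_def space_restrict_space)
    ultimately show ?thesis
      by (simp add: dynamic_solver_def F_def)
  qed
  ultimately show ?thesis
    by (subst measurable_cong) auto
qed

end
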